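(* Let $U\subset\mathbb{R}^d$ be bounded and open, $T>0$, $\Omega=U\times(0,T]$, and let $\Gamma(\Omega)=(\overline U\times\{0\})\cup(\partial U\times(0,T])$ be its parabolic boundary. Let $P$ be a polynomial, let $u,v\in\mathcal{C}^{2,1}(\Omega)$, and let $a_0>0$ be a constant such that $P(u(x,t))\ge a_0$ for all $(x,t)\in\Omega$. If $$Lv:=\frac{\partial v}{\partial t}-P(u)\Delta v>0\quad\text{in }\Omega,$$ then $v(x,t)\ge\min_{\Gamma(\Omega)}v$ for all $(x,t)\in\Omega$.
   Context: $\mathcal{C}^{2,1}(\Omega)$ is the class of functions continuous on $\overline\Omega$ that have two continuous derivatives in $x$ and one continuous derivative in $t$ in $\Omega$ (at $t=T$ the time derivative is the one-sided derivative from below). $\Delta$ is the Laplacian in $x\in\mathbb{R}^d$. *)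

theory Defs
  imports "HOL-Analysis.Analysis" "HOL-Computational_Algebra.Polynomial"
begin

definition parabolic_domain :: "(real ^ 'd) set \<Rightarrow> real \<Rightarrow> ((real ^ 'd) \<times> real) set" where
  "parabolic_domain U T = U \<times> {0<..T}"

definition parabolic_boundary :: "(real ^ 'd) set \<Rightarrow> real \<Rightarrow> ((real ^ 'd) \<times> real) set" where
  "parabolic_boundary U T = (closure U \<times> {0}) \<union> (frontier U \<times> {0<..T})"

definition has_dx :: "'d \<Rightarrow> ((real ^ 'd) \<times> real \<Rightarrow> real) \<Rightarrow> (real ^ 'd) \<times> real \<Rightarrow> bool" where
  "has_dx i f z \<longleftrightarrow> (\<lambda>s. f (fst z + s *\<^sub>R axis i 1, snd z)) field_differentiable (at 0)"

definition dx :: "'d \<Rightarrow> ((real ^ 'd) \<times> real \<Rightarrow> real) \<Rightarrow> (real ^ 'd) \<times> real \<Rightarrow> real" where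
  "dx i f z = deriv (\<lambda>s. f (fst z + s *\<^sub>R axis i 1, snd z)) 0"

text \<open>The time derivative is taken within \<open>(0, T]\<close>: this is the ordinary derivative for
  \<open>0 < t < T\<close> and the one-sided derivative from below at \<open>t = T\<close>.\<close>

definition has_dt :: "real \<Rightarrow> ((real ^ 'd) \<times> real \<Rightarrow> real) \<Rightarrow> (real ^ 'd) \<times> real \<Rightarrow> bool" where
  "has_dt T f z \<longleftrightarrow> (\<lambda>s. f (fst z, s)) differentiable (at (snd z) within {0<..T})"

definition dt :: "real \<Rightarrow> ((real ^ 'd) \<times> real \<Rightarrow> real) \<Rightarrow> (real ^ 'd) \<times> real \<Rightarrow> real" where
  "dt T f z = vector_derivative (\<lambda>s. f (fst z, s)) (at (snd z) within {0<..T})"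

definition laplacian_x :: "((real ^ 'd) \<times> real \<Rightarrow> real) \<Rightarrow> (real ^ 'd) \<times> real \<Rightarrow> real" where
  "laplacian_x f z = (\<Sum>i\<in>UNIV. dx i (dx i f) z)"

definition C21 :: "(real ^ 'd) set \<Rightarrow> real \<Rightarrow> ((real ^ 'd) \<times> real \<Rightarrow> real) set" where
  "C21 U T = {f.
     continuous_on (closure (parabolic_domain U T)) f \<and>
     (\<forall>i. (\<forall>z\<in>parabolic_domain U T. has_dx i f z) \<and>
          continuous_on (parabolic_domain U T) (dx i f)) \<and>
     (\<forall>i j. (\<forall>z\<in>parabolic_domain U T. has_dx i (dx j f) z) \<and>
            continuous_on (parabolic_domain U T) (dx i (dx j f))) \<and>
     (\<forall>z\<in>parabolic_domain U T. has_dt T f z) \<and>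
     continuous_on (parabolic_domain U T) (dt T f)}"

end

theory Submission
  imports Defs
begin

text \<open>
  By compactness \<open>v\<close> attains its minimum over \<open>closure U \<times> [0, T]\<close>. At a minimum point
  in \<open>U \<times> (0, T]\<close> one would have \<open>dt T v \<le> 0\<close> (compare with earlier times) and
  \<open>laplacian_x v \<ge> 0\<close>, contradicting \<open>Lv > 0\<close> as \<open>P(u) > 0\<close>; so the minimum point lies on the
  parabolic boundary.
\<close>

text \<open>If \<open>D\<close> were negative, \<open>g'\<close>, which vanishes at the minimum,
  would be negative just to the right of \<open>a\<close>, and the mean value theorem would push
  \<open>g\<close> below \<open>g a\<close>.\<close>

lemma local_min_second_derivative_nonneg:
  fixes g g' :: "real \<Rightarrow> real"
  assumes d: "d > 0" and g: "\<And>s. \<bar>s - a\<bar> < d \<Longrightarrow> (g has_real_derivative g' s) (at s)"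
    and g': "(g' has_real_derivative D) (at a)"
    and min: "\<And>s. \<bar>s - a\<bar> < d \<Longrightarrow> g a \<le> g s"
  shows "D \<ge> 0"
proof (rule ccontr)
  assume "\<not> D \<ge> 0"
  then have "D < 0" by simp
  have "g' a = 0"
    using DERIV_local_min[OF g[of a] d] min d by (simp add: abs_minus_commute)
  with DERIV_neg_dec_right[OF g' \<open>D < 0\<close>] obtain e
    where e: "e > 0" "\<And>h. 0 < h \<Longrightarrow> h < e \<Longrightarrow> g' (a + h) < 0" by auto
  \<comment> \<open>Below \<open>d\<close>, minimality applies at \<open>a + h\<close>; below
    \<open>e\<close>, \<open>g'\<close> is negative throughout the interval from \<open>a\<close> to
    \<open>a + h\<close>.\<close>
  define h where "h = min d e / 2"
  have h: "0 < h" "h < d" "h < e" using d e(1) by (auto simp: h_def)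
  obtain \<xi> where \<xi>: "a < \<xi>" "\<xi> < a + h" "g (a + h) - g a = (a + h - a) * g' \<xi>"
    using MVT2[of a "a + h" g g'] g h by auto
  have "g' \<xi> < 0" using e(2)[of "\<xi> - a"] \<xi> h by simp
  with \<xi>(3) mult_pos_neg[OF h(1)] have "g (a + h) < g a" by fastforce
  with min[of "a + h"] h show False by simp
qed

text \<open>Restricting \<open>f\<close> to the line through \<open>x\<close> along the
  \<open>i\<close>-th axis, with time frozen, reduces this to the one-variable second derivative
  test.\<close>

lemma dx_dx_nonneg_at_min:
  fixes x :: "real ^ 'd"
  assumes "open U" "x \<in> U"
    and f: "\<And>y. y \<in> U \<Longrightarrow> has_dx i f (y, t)" and f': "has_dx i (dx i f) (x, t)"
    and min: "\<And>y. y \<in> U \<Longrightarrow> f (x, t) \<le> f (y, t)"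
  shows "dx i (dx i f) (x, t) \<ge> 0"
proof -
  obtain d where d: "d > 0" "ball x d \<subseteq> U"
    using assms(1,2) open_contains_ball by blast
  have inU: "x + s *\<^sub>R axis i 1 \<in> U" if "\<bar>s\<bar> < d" for s
    using that d(2) by (auto simp: dist_norm subset_iff)
  define g where "g s = f (x + s *\<^sub>R axis i 1, t)" for s
  define g' where "g' s = dx i f (x + s *\<^sub>R axis i 1, t)" for s
  have "(g has_real_derivative g' s) (at s)" if "\<bar>s\<bar> < d" for s
  proof -
    \<comment> \<open>\<open>dx\<close> is always a derivative at parameter 0 of a line based at the
      point itself, so a translation by \<open>s\<close> turns it into the derivative of
      \<open>g\<close> at \<open>s\<close>.\<close>
    have "((\<lambda>r. f (x + s *\<^sub>R axis i 1 + r *\<^sub>R axis i 1, t)) has_real_derivative g' s) (at 0)"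
      using f[OF inU[OF that]] DERIV_deriv_iff_field_differentiable
      by (auto simp: has_dx_def dx_def g'_def)
    then have "((\<lambda>r. g (r + s)) has_real_derivative g' s) (at 0)"
      by (simp add: g_def algebra_simps)
    then show ?thesis using DERIV_shift[of g "g' s" 0 s] by simp
  qed
  moreover have "(g' has_real_derivative dx i (dx i f) (x, t)) (at 0)"
    using f' DERIV_deriv_iff_field_differentiable
    unfolding has_dx_def dx_def[of i "dx i f"] g'_def[abs_def] by auto
  ultimately show ?thesis
    using local_min_second_derivative_nonneg[of d 0 g g'] d(1) min inU by (simp add: g_def)
qed

text \<open>A positive derivative would make \<open>f\<close> strictly smaller at slightly earlier
  times. Only the past is compared, so \<open>t = T\<close> needs no separate case.\<close>

lemma dt_nonpos_at_min:
  fixes x :: "real ^ 'd"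
  assumes t: "t \<in> {0<..T}" and f: "has_dt T f (x, t)"
    and min: "\<And>s. s \<in> {0<..T} \<Longrightarrow> f (x, t) \<le> f (x, s)"
  shows "dt T f (x, t) \<le> 0"
proof (rule ccontr)
  assume "\<not> dt T f (x, t) \<le> 0"
  then have pos: "dt T f (x, t) > 0" by simp
  have "((\<lambda>s. f (x, s)) has_real_derivative dt T f (x, t)) (at t within {0<..T})"
    using f by (simp add: has_dt_def dt_def vector_derivative_works
        has_real_derivative_iff_has_vector_derivative)
  from has_real_derivative_pos_inc_left[OF this pos] obtain d where d: "d > 0"
    "\<And>h. h > 0 \<Longrightarrow> t - h \<in> {0<..T} \<Longrightarrow> h < d \<Longrightarrow> f (x, t - h) < f (x, t)" by blast
  \<comment> \<open>The bound by \<open>t / 2\<close> keeps \<open>t - h\<close> positive, hence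
    inside the time interval.\<close>
  define h where "h = min d t / 2"
  have "h > 0" "h < d" "t - h \<in> {0<..T}" using d(1) t by (auto simp: h_def)
  with d(2) min show False by fastforce
qed

theorem lemma2:
  fixes U :: "(real ^ 'd) set" and T a0 :: real and P :: "real poly"
    and u v :: "(real ^ 'd) \<times> real \<Rightarrow> real"
  assumes "bounded U" and "open U" and "T > 0"
    and "u \<in> C21 U T" and "v \<in> C21 U T"
    and "a0 > 0" and "\<forall>z\<in>parabolic_domain U T. poly P (u z) \<ge> a0"
    and "\<forall>z\<in>parabolic_domain U T. dt T v z - poly P (u z) * laplacian_x v z > 0"
  shows "\<forall>z\<in>parabolic_domain U T.
           \<exists>p. is_arg_min v (\<lambda>q. q \<in> parabolic_boundary U T) p \<and> v z \<ge> v p"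
proof
  fix z assume z: "z \<in> parabolic_domain U T"
  define K where "K = closure U \<times> {0..T}"
  have clK: "closure (parabolic_domain U T) = K"
    using \<open>T > 0\<close> by (simp add: K_def parabolic_domain_def closure_Times)
  \<comment> \<open>As \<open>U\<close> is open, its closure is \<open>U\<close> together with its
    frontier; the slice at time 0 belongs wholly to the boundary.\<close>
  have K: "K = parabolic_domain U T \<union> parabolic_boundary U T"
    using \<open>open U\<close> \<open>T > 0\<close> closure_subset[of U]
    by (auto simp: K_def parabolic_domain_def parabolic_boundary_def frontier_def interior_open)
  have "compact K" using \<open>bounded U\<close> by (simp add: K_def compact_Times)
  moreover have "continuous_on K v" using \<open>v \<in> C21 U T\<close> clK by (simp add: C21_def)
  ultimately obtain p where p: "p \<in> K" "\<And>y. y \<in> K \<Longrightarrow> v p \<le> v y"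
    using continuous_attains_inf[of K v] z K by blast
  have "p \<notin> parabolic_domain U T"
  proof
    assume pD: "p \<in> parabolic_domain U T"
    obtain x t where xt: "p = (x, t)" "x \<in> U" "t \<in> {0<..T}"
      using pD by (auto simp: parabolic_domain_def)
    have min: "v (x, t) \<le> v (y, s)" if "y \<in> U" "s \<in> {0<..T}" for y s
      using p(2)[of "(y, s)"] K that by (simp add: parabolic_domain_def xt(1))
    have "dx i (dx i v) p \<ge> 0" for i
      unfolding xt(1) using \<open>v \<in> C21 U T\<close> xt min
      by (intro dx_dx_nonneg_at_min[OF \<open>open U\<close>]) (auto simp: C21_def parabolic_domain_def)
    then have "laplacian_x v p \<ge> 0" by (simp add: laplacian_x_def sum_nonneg)
    moreover have "poly P (u p) \<ge> 0" using assms(6,7) pD by fastforce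
    ultimately have "poly P (u p) * laplacian_x v p \<ge> 0" by simp
    moreover have "dt T v p \<le> 0"
      unfolding xt(1) using \<open>v \<in> C21 U T\<close> xt min
      by (intro dt_nonpos_at_min) (auto simp: C21_def parabolic_domain_def)
    ultimately show False using assms(8) pD by fastforce
  qed
  \<comment> \<open>A minimizer over \<open>K\<close> that lies on the boundary also minimizes
    there, so the minimum over the boundary is attained.\<close>
  then have "is_arg_min v (\<lambda>q. q \<in> parabolic_boundary U T) p"
    using p K by (auto simp: is_arg_min_linorder)
  then show "\<exists>p. is_arg_min v (\<lambda>q. q \<in> parabolic_boundary U T) p \<and> v z \<ge> v p"
    using p(2) z K by blast
qed

end
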